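(* All Darboux transformations of operators $\mathcal{L} = D_xD_y + aD_x + bD_y + c\in K[D]$ generated by operators $\mathcal{M} = D_x + qD_y + r\in K[D]$, $q\neq 0$, are parametrized by non-constant $z\in K$ in the following sense: for such a pair $(\mathcal{L},\mathcal{M})$ there exists a Darboux transformation of $\mathcal{L}$ generated by $\mathcal{M}$ if and only if there exists $z\in K$ with $z_x\neq0$, $z_y\ne 0$ such that the gauged evolution invariants $(q, I_2, I_3)$ of the pair $(\mathcal{L},\mathcal{M})$ are $$q = -\frac{z_x}{z_y}, \qquad I_2 = B_y - A_x, \qquad I_3 = -A_x + \frac{A\cdot B}{2}, \qquad\text{where } A = \frac{z_{xy}}{z_x},\quad B = \frac{z_{xy}}{z_y}$$ (so that $q=-B/A$ whenever $z_{xy}\neq 0$).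
   Context: $K$ is a differential field of characteristic zero with commuting derivations $\partial_x,\partial_y$; it is assumed to be differentially closed (or, at least, to contain the solutions of all the partial differential equations with coefficients in $K$ that are needed). Subscripts $x,y$ on elements of $K$ denote derivatives. $K[D]=K[D_x,D_y]$ is the ring of linear partial differential operators over $K$; $a,b,c,q,r\in K$ need not be constants. The symbol of $\sum_{i+j\le d}a_{ij}D_x^iD_y^j$ of order $d$ is $\sum_{i+j=d}a_{ij}X^iY^j$. A Darboux transformation of $\mathcal{L}$ generated by $\mathcal{M}$ exists if there are $\mathcal{N},\mathcal{L}_1\in K[D]$ with $\mathrm{Sym}(\mathcal{L}_1)=\mathrm{Sym}(\mathcal{L})$ and $\mathcal{N}\circ\mathcal{L}=\mathcal{L}_1\circ\mathcal{M}$. The gauged evolution invariants of the pair $(\mathcal{L},\mathcal{M})$ are $I_1=q$, $$I_2 = 2m - R_y + \left(\frac{R}{q}\right)_x,\qquad I_3 = 2h + \left(\frac{R}{q}\right)_x - \frac{R^2}{2q},$$ where $m = a_x - b_y$, $h = ab - c + a_x$, $R = r - b - qa$. *)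

theory Defs
  imports "HOL-Algebra.Algebraic_Closure_Type" "HOL-Library.Poly_Mapping"
begin

section \<open>Differential fields with two commuting derivations\<close>

locale differential_field =
  fixes dx dy :: "'a::field_char_0 \<Rightarrow> 'a"
  assumes dx_add: "dx (u + v) = dx u + dx v"
    and dx_mult: "dx (u * v) = dx u * v + u * dx v"
    and dy_add: "dy (u + v) = dy u + dy v"
    and dy_mult: "dy (u * v) = dy u * v + u * dy v"
    and dx_dy_commute: "dx (dy u) = dy (dx u)"

text \<open>Extensions of \<open>(K, dx, dy)\<close> have to be quantified over in the definition of
  differential closedness, so they are given as structures \<open>E\<close> with an explicit carrier,
  together with derivations \<open>ex\<close>, \<open>ey\<close> on that carrier and an embedding \<open>\<iota>\<close> of \<open>K\<close>
  (injective, being a homomorphism of fields).\<close>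

definition differential_extension ::
  "('a::field_char_0 \<Rightarrow> 'a) \<Rightarrow> ('a \<Rightarrow> 'a) \<Rightarrow> 'b ring \<Rightarrow> ('b \<Rightarrow> 'b) \<Rightarrow> ('b \<Rightarrow> 'b) \<Rightarrow> ('a \<Rightarrow> 'b) \<Rightarrow> bool"
  where "differential_extension dx dy E ex ey \<iota> \<longleftrightarrow>
    field E \<and>
    (\<forall>u\<in>carrier E. ex u \<in> carrier E \<and> ey u \<in> carrier E \<and> ex (ey u) = ey (ex u)) \<and>
    (\<forall>u\<in>carrier E. \<forall>v\<in>carrier E.
       ex (u \<oplus>\<^bsub>E\<^esub> v) = ex u \<oplus>\<^bsub>E\<^esub> ex v \<and>
       ex (u \<otimes>\<^bsub>E\<^esub> v) = (ex u \<otimes>\<^bsub>E\<^esub> v) \<oplus>\<^bsub>E\<^esub> (u \<otimes>\<^bsub>E\<^esub> ex v) \<and>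
       ey (u \<oplus>\<^bsub>E\<^esub> v) = ey u \<oplus>\<^bsub>E\<^esub> ey v \<and>
       ey (u \<otimes>\<^bsub>E\<^esub> v) = (ey u \<otimes>\<^bsub>E\<^esub> v) \<oplus>\<^bsub>E\<^esub> (u \<otimes>\<^bsub>E\<^esub> ey v)) \<and>
    \<iota> \<in> ring_hom ring_of_type_algebra E \<and>
    (\<forall>u. \<iota> (dx u) = ex (\<iota> u) \<and> \<iota> (dy u) = ey (\<iota> u))"

text \<open>Differential polynomials over \<open>K\<close> in the differential indeterminates \<open>Ind 0, Ind 1, \<dots>\<close>
  are represented by expressions; only their values matter below.\<close>

datatype 'a diff_poly =
    Const 'a
  | Ind nat
  | Plus "'a diff_poly" "'a diff_poly"
  | Times "'a diff_poly" "'a diff_poly"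
  | DerivX "'a diff_poly"
  | DerivY "'a diff_poly"

primrec dp_value ::
  "'b ring \<Rightarrow> ('b \<Rightarrow> 'b) \<Rightarrow> ('b \<Rightarrow> 'b) \<Rightarrow> ('a \<Rightarrow> 'b) \<Rightarrow> (nat \<Rightarrow> 'b) \<Rightarrow> 'a diff_poly \<Rightarrow> 'b"
  where
    "dp_value E ex ey \<iota> \<sigma> (Const u) = \<iota> u"
  | "dp_value E ex ey \<iota> \<sigma> (Ind i) = \<sigma> i"
  | "dp_value E ex ey \<iota> \<sigma> (Plus s t) = dp_value E ex ey \<iota> \<sigma> s \<oplus>\<^bsub>E\<^esub> dp_value E ex ey \<iota> \<sigma> t"
  | "dp_value E ex ey \<iota> \<sigma> (Times s t) = dp_value E ex ey \<iota> \<sigma> s \<otimes>\<^bsub>E\<^esub> dp_value E ex ey \<iota> \<sigma> t"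
  | "dp_value E ex ey \<iota> \<sigma> (DerivX t) = ex (dp_value E ex ey \<iota> \<sigma> t)"
  | "dp_value E ex ey \<iota> \<sigma> (DerivY t) = ey (dp_value E ex ey \<iota> \<sigma> t)"

definition dp_solvable ::
  "'b ring \<Rightarrow> ('b \<Rightarrow> 'b) \<Rightarrow> ('b \<Rightarrow> 'b) \<Rightarrow> ('a \<Rightarrow> 'b) \<Rightarrow> 'a diff_poly set \<Rightarrow> 'a diff_poly \<Rightarrow> bool"
  where "dp_solvable E ex ey \<iota> F g \<longleftrightarrow>
    (\<exists>\<sigma>. (\<forall>i. \<sigma> i \<in> carrier E) \<and>
         (\<forall>f\<in>F. dp_value E ex ey \<iota> \<sigma> f = \<zero>\<^bsub>E\<^esub>) \<and>
         dp_value E ex ey \<iota> \<sigma> g \<noteq> \<zero>\<^bsub>E\<^esub>)"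

text \<open>\<open>K\<close> is differentially closed if every finite system \<open>f = 0 (f \<in> F), g \<noteq> 0\<close> of differential
  polynomials over \<open>K\<close> that is solvable in some differential field extension of \<open>K\<close> is solvable
  in \<open>K\<close>.  It is no restriction that the carrier of the extension is a subset of the type of \<open>K\<close>:
  a solution of a finite system lies in an extension generated over \<open>K\<close> by countably many
  elements, which has the cardinality of the infinite field \<open>K\<close> and so has an isomorphic copy
  there.  (The operations of \<open>E\<close> and the embedding \<open>\<iota>\<close> are arbitrary; \<open>E\<close> is not a subfield.)\<close>

definition differentially_closed :: "('a::field_char_0 \<Rightarrow> 'a) \<Rightarrow> ('a \<Rightarrow> 'a) \<Rightarrow> bool"
  where "differentially_closed dx dy \<longleftrightarrow>
    (\<forall>(F :: 'a diff_poly set) g. finite F \<longrightarrow>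
       (\<exists>(E :: 'a ring) ex ey \<iota>. differential_extension dx dy E ex ey \<iota> \<and>
                                 dp_solvable E ex ey \<iota> F g) \<longrightarrow>
       dp_solvable ring_of_type_algebra dx dy id F g)"


section \<open>Linear partial differential operators\<close>

text \<open>The operator \<open>\<Sum> a\<^sub>i\<^sub>j D\<^sub>x\<^sup>i D\<^sub>y\<^sup>j\<close> is the finitely supported family \<open>(i, j) \<mapsto> a\<^sub>i\<^sub>j\<close>.  The
  polynomials of \<open>K[X,Y]\<close>, in which symbols live, have the same representation.\<close>

type_synonym 'a pdo = "(nat \<times> nat) \<Rightarrow>\<^sub>0 'a"

text \<open>Composition, by the Leibniz rule
  \<open>D\<^sub>x\<^sup>i D\<^sub>y\<^sup>j \<circ> v = \<Sum> (i choose s) (j choose t) (\<partial>\<^sub>x\<^sup>s \<partial>\<^sub>y\<^sup>t v) D\<^sub>x\<^sup>i\<^sup>-\<^sup>s D\<^sub>y\<^sup>j\<^sup>-\<^sup>t\<close>.  The product \<open>P * Q\<close> that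
  \<open>Poly_Mapping\<close> provides is the commutative one of \<open>K[X,Y]\<close> and is not used for operators.\<close>

definition pdo_comp :: "('a::field_char_0 \<Rightarrow> 'a) \<Rightarrow> ('a \<Rightarrow> 'a) \<Rightarrow> 'a pdo \<Rightarrow> 'a pdo \<Rightarrow> 'a pdo"
  where "pdo_comp dx dy P Q =
    (\<Sum>(i, j)\<in>Poly_Mapping.keys P. \<Sum>(k, l)\<in>Poly_Mapping.keys Q. \<Sum>s\<le>i. \<Sum>t\<le>j.
       Poly_Mapping.single (i - s + k, j - t + l)
         (Poly_Mapping.lookup P (i, j) * of_nat (i choose s) * of_nat (j choose t) *
          (dx ^^ s) ((dy ^^ t) (Poly_Mapping.lookup Q (k, l)))))"

definition pdo_order :: "'a::zero pdo \<Rightarrow> nat"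
  where "pdo_order P = (if P = 0 then 0 else Max ((\<lambda>(i, j). i + j) ` Poly_Mapping.keys P))"

definition Sym :: "'a::comm_monoid_add pdo \<Rightarrow> 'a pdo"
  where "Sym P = (\<Sum>(i, j)\<in>{(i, j) \<in> Poly_Mapping.keys P. i + j = pdo_order P}.
    Poly_Mapping.single (i, j) (Poly_Mapping.lookup P (i, j)))"

definition darboux_transformation_exists ::
  "('a::field_char_0 \<Rightarrow> 'a) \<Rightarrow> ('a \<Rightarrow> 'a) \<Rightarrow> 'a pdo \<Rightarrow> 'a pdo \<Rightarrow> bool"
  where "darboux_transformation_exists dx dy L M \<longleftrightarrow>
    (\<exists>N L1. Sym L1 = Sym L \<and> pdo_comp dx dy N L = pdo_comp dx dy L1 M)"

definition L_op :: "'a::field_char_0 \<Rightarrow> 'a \<Rightarrow> 'a \<Rightarrow> 'a pdo"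
  where "L_op a b c = Poly_Mapping.single (1, 1) 1 + Poly_Mapping.single (1, 0) a
    + Poly_Mapping.single (0, 1) b + Poly_Mapping.single (0, 0) c"

definition M_op :: "'a::field_char_0 \<Rightarrow> 'a \<Rightarrow> 'a pdo"
  where "M_op q r = Poly_Mapping.single (1, 0) 1 + Poly_Mapping.single (0, 1) q
    + Poly_Mapping.single (0, 0) r"


section \<open>Gauged evolution invariants of the pair \<open>(L_op a b c, M_op q r)\<close>\<close>

definition inv_m :: "('a::field_char_0 \<Rightarrow> 'a) \<Rightarrow> ('a \<Rightarrow> 'a) \<Rightarrow> 'a \<Rightarrow> 'a \<Rightarrow> 'a"
  where "inv_m dx dy a b = dx a - dy b"

definition inv_h :: "('a::field_char_0 \<Rightarrow> 'a) \<Rightarrow> 'a \<Rightarrow> 'a \<Rightarrow> 'a \<Rightarrow> 'a"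
  where "inv_h dx a b c = a * b - c + dx a"

definition inv_R :: "'a::field_char_0 \<Rightarrow> 'a \<Rightarrow> 'a \<Rightarrow> 'a \<Rightarrow> 'a"
  where "inv_R a b q r = r - b - q * a"

definition inv_I2 :: "('a::field_char_0 \<Rightarrow> 'a) \<Rightarrow> ('a \<Rightarrow> 'a) \<Rightarrow> 'a \<Rightarrow> 'a \<Rightarrow> 'a \<Rightarrow> 'a \<Rightarrow> 'a"
  where "inv_I2 dx dy a b q r =
    2 * inv_m dx dy a b - dy (inv_R a b q r) + dx (inv_R a b q r / q)"

definition inv_I3 :: "('a::field_char_0 \<Rightarrow> 'a) \<Rightarrow> 'a \<Rightarrow> 'a \<Rightarrow> 'a \<Rightarrow> 'a \<Rightarrow> 'a \<Rightarrow> 'a"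
  where "inv_I3 dx a b c q r =
    2 * inv_h dx a b c + dx (inv_R a b q r / q) - (inv_R a b q r)\<^sup>2 / (2 * q)"

text \<open>The invariants \<open>(q, I2, I3)\<close> of the pair are the ones determined by \<open>z\<close>.  As the derivations
  commute, \<open>z\<^sub>x\<^sub>y\<close> is \<open>dy (dx z)\<close>.\<close>

definition invariants_given_by ::
  "('a::field_char_0 \<Rightarrow> 'a) \<Rightarrow> ('a \<Rightarrow> 'a) \<Rightarrow> 'a \<Rightarrow> 'a \<Rightarrow> 'a \<Rightarrow> 'a \<Rightarrow> 'a \<Rightarrow> 'a \<Rightarrow> bool"
  where "invariants_given_by dx dy a b c q r z \<longleftrightarrow>
    (let A = dy (dx z) / dx z; B = dy (dx z) / dy z in
       q = - (dx z / dy z) \<and>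
       inv_I2 dx dy a b q r = dy B - dx A \<and>
       inv_I3 dx a b c q r = - dx A + A * B / 2)"

end

theory Submission
  imports Defs "HOL-Algebra.Weak_Morphisms"
begin

text \<open>The pair \<open>(L, M)\<close> admits a Darboux transformation exactly when the system \<open>L u = M u = 0\<close> has a
  two-dimensional space of solutions, and the parameter is the quotient \<open>z = u\<^sub>2 / u\<^sub>1\<close> of two
  independent ones.  Indeed the gauge transformation by \<open>u\<^sub>1\<close> leaves \<open>q\<close>, \<open>I\<^sub>2\<close>, \<open>I\<^sub>3\<close> unchanged and
  makes \<open>c\<close> and \<open>r\<close> vanish; the transformed operators annihilate \<open>z\<close>, that is,
  with the new \<open>a\<close> and \<open>b\<close>, \<open>z\<^sub>x\<^sub>y + a z\<^sub>x + b z\<^sub>y = 0\<close> and \<open>z\<^sub>x + q z\<^sub>y = 0\<close>, and the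
  formulas for the invariants can be read off.

  The proof expresses this through integrability conditions on \<open>(q, I\<^sub>2, I\<^sub>3)\<close> and never forms the
  space of solutions.  On the side of the operators, comparing coefficients in \<open>N \<circ> L = L\<^sub>1 \<circ> M\<close> forces \<open>N\<close>
  to have order one, determines \<open>N\<close> and \<open>L\<^sub>1\<close>, and leaves two equations in \<open>a, b, c, q, r\<close>.  These
  are equivalent to
  \<open>I\<^sub>2 = - (q\<^sub>y / q)\<^sub>x\<close> and \<open>((I\<^sub>3 - I\<^sub>2) / q)\<^sub>x + (q\<^sub>y / q) I\<^sub>3 + (I\<^sub>3)\<^sub>y = 0\<close>
  (\<open>darboux_transformation_exists_iff_integrability_conditions\<close>).

  On the side of \<open>z\<close>, put \<open>A = z\<^sub>x\<^sub>y / z\<^sub>x\<close> and \<open>w = z\<^sub>y\<close>.  That \<open>z\<close> yields \<open>(q, I\<^sub>2, I\<^sub>3)\<close> amounts to a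
  Riccati system for \<open>A\<close>, a linear one for \<open>w\<close> and a linear one for \<open>z\<close>, each prescribing both
  derivatives of its unknown as polynomials in it.  The two conditions above make all three compatible
  (\<open>parameter_of_integrability\<close>) and follow from the equality of mixed derivatives when \<open>z\<close> exists
  (\<open>integrability_of_parameter\<close>).

  Compatible systems \<open>t\<^sub>x = P(t)\<close>, \<open>t\<^sub>y = Q(t)\<close> are solvable in \<open>K\<close> (\<open>polynomial_system_solvable\<close>).  A
  solution, even a nonzero one, exists in the field \<open>K(T)\<close> with derivations extended by \<open>T\<^sub>x = P(T)\<close>,
  \<open>T\<^sub>y = Q(T)\<close>, which are well defined and commute; differential closedness brings a nonzero solution
  down to \<open>K\<close>.\<close>

section \<open>Derivations of polynomials and rational functions\<close>

locale derivation =
  fixes d :: "'a::comm_ring_1 \<Rightarrow> 'a"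
  assumes add: "d (u + v) = d u + d v"
    and mult: "d (u * v) = d u * v + u * d v"
begin

lemma zero [simp]: "d 0 = 0"
  using add[of 0 0] by simp

lemma one [simp]: "d 1 = 0"
  using mult[of 1 1] by simp

lemma minus: "d (- u) = - d u"
  using add[of u "- u"] by (simp add: eq_neg_iff_add_eq_0 add.commute)

lemma diff: "d (u - v) = d u - d v"
  using add[of u "- v"] by (simp add: minus)

lemma numeral [simp]: "d (numeral k) = 0"
proof -
  have "d (of_nat n) = 0" for n
    by (induction n) (simp_all add: add)
  from this[of "numeral k"] show ?thesis by simp
qed

end

lemma derivation_divide:
  fixes d :: "'a::field \<Rightarrow> 'a"
  assumes "derivation d" "v \<noteq> 0"
  shows "d (u / v) = d u / v - u * d v / v\<^sup>2"
  using derivation.mult[OF assms(1), of "u / v" v] assms(2)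
  by (simp add: field_simps power2_eq_square)

lemma derivation_commutator:
  assumes "derivation d" "derivation e"
  shows "derivation (\<lambda>u. d (e u) - e (d u))"
  by (unfold_locales)
     (simp_all add: derivation.add[OF assms(1)] derivation.add[OF assms(2)]
       derivation.mult[OF assms(1)] derivation.mult[OF assms(2)] algebra_simps)

text \<open>This is the extension of the derivation \<open>d\<close> of \<open>K\<close> to \<open>K[T]\<close> with \<open>T \<mapsto> P\<close>: in \<open>K[T]\<close> with the
  derivations \<open>poly_derivation dx P\<close> and \<open>poly_derivation dy Q\<close> the indeterminate is a generic
  solution of \<open>t\<^sub>x = P(t)\<close>, \<open>t\<^sub>y = Q(t)\<close>.\<close>

definition poly_derivation :: "('a::idom \<Rightarrow> 'a) \<Rightarrow> 'a poly \<Rightarrow> 'a poly \<Rightarrow> 'a poly"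
  where "poly_derivation d P p = map_poly d p + pderiv p * P"

lemma derivation_poly_derivation:
  fixes d :: "'a::idom \<Rightarrow> 'a"
  assumes "derivation d"
  shows "derivation (poly_derivation d P)"
proof -
  interpret derivation d by fact
  have add': "map_poly d (p + q) = map_poly d p + map_poly d q" for p q
    by (rule poly_eqI) (simp add: coeff_map_poly add)
  have smult': "map_poly d (smult u p) = smult (d u) p + smult u (map_poly d p)" for u p
    by (rule poly_eqI) (simp add: coeff_map_poly mult)
  have mult': "map_poly d (p * q) = map_poly d p * q + p * map_poly d q" for p q
  proof (induction p)
    case (pCons u p)
    then show ?case
      by (simp add: add' smult' map_poly_pCons algebra_simps)
  qed simp
  show ?thesis
    by unfold_locales
      (simp_all add: poly_derivation_def add' mult' pderiv_add pderiv_mult algebra_simps)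
qed

lemma poly_derivation_const [simp]: "poly_derivation d P [:u:] = [:d u:]" if "d 0 = 0"
  using that by (simp add: poly_derivation_def map_poly_pCons pderiv_pCons)

lemma poly_derivation_X:
  "derivation d \<Longrightarrow> poly_derivation d P [:0, 1:] = P"
  by (simp add: poly_derivation_def map_poly_pCons pderiv_pCons derivation.zero derivation.one)

text \<open>Constants and \<open>T\<close> generate \<open>K[T]\<close>, so a derivation is determined by its values on them.\<close>

lemma poly_derivation_eq_0:
  assumes "derivation (D :: 'a::idom poly \<Rightarrow> 'a poly)" "\<And>u. D [:u:] = 0" "D [:0, 1:] = 0"
  shows "D p = 0"
proof (induction p)
  case 0
  then show ?case by (simp add: derivation.zero[OF assms(1)])
next
  case (pCons u p)
  have "pCons u p = [:u:] + [:0, 1:] * p" by simp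
  then show ?case
    by (simp only: derivation.add[OF assms(1)] derivation.mult[OF assms(1)] assms pCons.IH) simp
qed

text \<open>The commutator of two derivations is a derivation.  It vanishes on \<open>K\<close> because \<open>d\<close> and \<open>e\<close>
  commute, and the last hypothesis says that it vanishes at \<open>T\<close>.\<close>

lemma poly_derivations_commute:
  fixes d e :: "'a::idom \<Rightarrow> 'a"
  assumes d: "derivation d" and e: "derivation e" and "\<And>u. d (e u) = e (d u)"
    and "poly_derivation d P Q = poly_derivation e Q P"
  shows "poly_derivation d P (poly_derivation e Q p) = poly_derivation e Q (poly_derivation d P p)"
proof -
  have "poly_derivation d P (poly_derivation e Q p) - poly_derivation e Q (poly_derivation d P p) = 0"
    by (rule poly_derivation_eq_0[where D = "\<lambda>p. poly_derivation d P (poly_derivation e Q p)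
          - poly_derivation e Q (poly_derivation d P p)"])
      (use assms in \<open>simp_all add: derivation_commutator derivation_poly_derivation
        derivation.zero poly_derivation_X\<close>)
  then show ?thesis by simp
qed

text \<open>The quotient rule, applied to an arbitrary representation of the fraction; for a derivation the
  choice does not matter, by \<open>fract_derivation_Fract\<close>.\<close>

definition fract_derivation :: "('a::idom \<Rightarrow> 'a) \<Rightarrow> 'a fract \<Rightarrow> 'a fract"
  where "fract_derivation d x =
    (let (n, m) = SOME (n, m). m \<noteq> 0 \<and> x = Fract n m in Fract (d n * m - n * d m) (m * m))"

lemma fract_derivation_Fract:
  assumes "derivation d" "v \<noteq> 0"
  shows "fract_derivation d (Fract u v) = Fract (d u * v - u * d v) (v * v)"
proof -
  define s where "s = (SOME (n, m). m \<noteq> 0 \<and> Fract u v = Fract n m)"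
  have "case s of (n, m) \<Rightarrow> m \<noteq> 0 \<and> Fract u v = Fract n m"
    unfolding s_def by (rule someI[of _ "(u, v)"]) (use assms in simp)
  then obtain n m where s: "s = (n, m)" and m: "m \<noteq> 0" and "Fract u v = Fract n m"
    by (cases s) auto
  then have eq: "u * m = n * v"
    using assms by (simp add: eq_fract)
  then have d_eq: "d u * m + u * d m = d n * v + n * d v"
    using derivation.mult[OF assms(1)] by metis
  \<comment> \<open>The two representations differ by a combination of the relation and its derivative.\<close>
  have "(d n * m - n * d m) * (v * v) = (d u * v - u * d v) * (m * m)"
  proof -
    have "(d u * v - u * d v) * (m * m) - (d n * m - n * d m) * (v * v)
      = v * m * ((d u * m + u * d m) - (d n * v + n * d v)) - (m * d v + v * d m) * (u * m - n * v)"
      by (simp add: algebra_simps)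
    then show ?thesis
      using eq d_eq by simp
  qed
  then show ?thesis
    using m assms unfolding fract_derivation_def s_def[symmetric] s by (simp add: eq_fract)
qed

lemma derivation_fract_derivation:
  assumes "derivation d"
  shows "derivation (fract_derivation d)"
proof
  interpret derivation d by fact
  fix x y :: "'a fract"
  obtain a b where x: "x = Fract a b" "b \<noteq> 0" by (cases x)
  obtain c e where y: "y = Fract c e" "e \<noteq> 0" by (cases y)
  show "fract_derivation d (x + y) = fract_derivation d x + fract_derivation d y"
    using x(2) y(2)
    by (simp add: x(1) y(1) fract_derivation_Fract[OF assms] eq_fract add mult algebra_simps)
  show "fract_derivation d (x * y) = fract_derivation d x * y + x * fract_derivation d y"
    using x(2) y(2)
    by (simp add: x(1) y(1) fract_derivation_Fract[OF assms] eq_fract add mult algebra_simps)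
qed

lemma fract_derivation_embed:
  "derivation d \<Longrightarrow> fract_derivation d (Fract u 1) = Fract (d u) 1"
  by (simp add: fract_derivation_Fract derivation.one)

text \<open>Again the commutator is a derivation, and a derivation that kills \<open>u\<close> and \<open>v\<close> kills \<open>u / v\<close>.\<close>

lemma fract_derivations_commute:
  fixes d e :: "'a::idom \<Rightarrow> 'a"
  assumes d: "derivation d" and e: "derivation e" and "\<And>u. d (e u) = e (d u)"
  shows "fract_derivation d (fract_derivation e x) = fract_derivation e (fract_derivation d x)"
proof -
  define C where "C x = fract_derivation d (fract_derivation e x)
    - fract_derivation e (fract_derivation d x)" for x
  have C: "derivation C"
    unfolding C_def by (intro derivation_commutator derivation_fract_derivation d e)
  have C0: "C (Fract u 1) = 0" for u
    by (simp add: C_def fract_derivation_embed assms)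
  obtain u v where x: "x = Fract u v" and v: "v \<noteq> 0" by (cases x)
  have "x * Fract v 1 = Fract u 1"
    using v by (simp add: x eq_fract)
  then have "C x * Fract v 1 = 0"
    using derivation.mult[OF C, of x "Fract v 1"] by (simp add: C0)
  moreover have "Fract v 1 \<noteq> 0"
    using v by (simp add: Zero_fract_def eq_fract)
  ultimately show ?thesis
    by (simp add: C_def)
qed

section \<open>Systems of first order over a differentially closed field\<close>

lemma infinite_type_pairing:
  assumes "infinite (UNIV :: 'a set)"
  obtains f :: "'a \<times> 'a \<Rightarrow> 'a" where "inj f"
proof -
  obtain f :: "'a \<times> 'a \<Rightarrow> 'a" where "inj_on f (UNIV \<times> UNIV)"
    using iffD2[OF card_of_ordLeq ordIso_imp_ordLeq[OF card_of_Times_same_infinite[OF assms]]]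
    by blast
  then show thesis using that by simp
qed

text \<open>Differential closedness speaks of extensions whose carrier is a set of elements of \<open>K\<close>.  The
  field \<open>K(T)\<close> has such a copy because \<open>K\<close> is infinite: with a pairing on \<open>K\<close>, lists of a given
  length are encoded by nested pairs, and the length itself as a natural number of \<open>K\<close>.\<close>

lemma rational_functions_embed:
  obtains f :: "'a::field_char_0 poly fract \<Rightarrow> 'a" where "inj f"
proof -
  have "infinite (UNIV :: 'a set)"
    using infinite_UNIV_char_0 .
  then obtain pair :: "'a \<times> 'a \<Rightarrow> 'a" where pair: "inj pair"
    by (rule infinite_type_pairing)
  define enc :: "'a list \<Rightarrow> 'a" where "enc xs = foldr (\<lambda>x y. pair (x, y)) xs 0" for xs
  have enc: "xs = ys" if "length xs = length ys" "enc xs = enc ys" for xs ys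
    using that
    by (induction xs ys rule: list_induct2) (auto simp: enc_def dest: injD[OF pair])
  define code where "code p = pair (of_nat (length (coeffs p)), enc (coeffs p))" for p
  have code: "inj code"
    by (rule injI) (auto simp: code_def coeffs_eq_iff dest!: injD[OF pair] intro: enc)
  define rep :: "'a poly fract \<Rightarrow> 'a poly \<times> 'a poly"
    where "rep x = (SOME s. x = Fract (fst s) (snd s))" for x
  have rep: "x = Fract (fst (rep x)) (snd (rep x))" for x
    unfolding rep_def by (rule someI_ex) (metis Fract_cases fst_conv snd_conv)
  have "inj (\<lambda>x. pair (map_prod code code (rep x)))"
  proof (rule injI)
    fix x y
    assume "pair (map_prod code code (rep x)) = pair (map_prod code code (rep y))"
    then have "rep x = rep y"
      using pair code by (meson injD prod.inj_map)
    then show "x = y" using rep by metis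
  qed
  then show thesis by (rule that)
qed

lemma dp_value_image_ring:
  fixes \<iota> :: "'a \<Rightarrow> 'b::field" and j :: "'b \<Rightarrow> 'c"
  assumes "inj j"
  shows "dp_value (image_ring j ring_of_type_algebra) (\<lambda>u. j (ex (inv_into UNIV j u)))
      (\<lambda>u. j (ey (inv_into UNIV j u))) (\<lambda>u. j (\<iota> u)) (\<lambda>i. j (\<sigma> i)) f
    = j (dp_value ring_of_type_algebra ex ey \<iota> \<sigma> f)"
  using assms
  by (induction f)
    (simp_all add: image_ring_def image_group_def monoid.defs ring_of_type_algebra_def)

text \<open>The form of differential closedness in which the extension is a field type: its operations are
  transported along the injection \<open>j\<close>.\<close>

lemma differentially_closed_solvable:
  fixes dx dy :: "'a::field_char_0 \<Rightarrow> 'a" and \<iota> :: "'a \<Rightarrow> 'b::field" and j :: "'b \<Rightarrow> 'a"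
  assumes closed: "differentially_closed dx dy" and j: "inj j"
    and ex: "derivation ex" and ey: "derivation ey" and comm: "\<And>u. ex (ey u) = ey (ex u)"
    and \<iota>: "\<And>u v. \<iota> (u + v) = \<iota> u + \<iota> v" "\<And>u v. \<iota> (u * v) = \<iota> u * \<iota> v" "\<iota> 1 = 1"
    and \<iota>_dx: "\<And>u. \<iota> (dx u) = ex (\<iota> u)" and \<iota>_dy: "\<And>u. \<iota> (dy u) = ey (\<iota> u)"
    and F: "finite F" "dp_solvable ring_of_type_algebra ex ey \<iota> F g"
  shows "dp_solvable ring_of_type_algebra dx dy id F g"
proof -
  let ?E = "image_ring j ring_of_type_algebra"
  let ?ex = "\<lambda>u. j (ex (inv_into UNIV j u))" and ?ey = "\<lambda>u. j (ey (inv_into UNIV j u))" and ?i = "\<lambda>u. j (\<iota> u)"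
  have E: "carrier ?E = range j" "\<zero>\<^bsub>?E\<^esub> = j 0"
    by (simp_all add: image_ring_def image_group_def monoid.defs ring_of_type_algebra_def)
  have "field ?E"
    by (rule field.inj_imp_image_ring_is_field[OF field_from_type_algebra])
      (use j in \<open>simp add: ring_of_type_algebra_def\<close>)
  then have "differential_extension dx dy ?E ?ex ?ey ?i"
    unfolding differential_extension_def
    using j comm \<iota> \<iota>_dx \<iota>_dy
    by (auto simp: image_ring_def image_group_def monoid.defs ring_of_type_algebra_def
        derivation.add[OF ex] derivation.add[OF ey] derivation.mult[OF ex] derivation.mult[OF ey]
        ring_hom_def)
  moreover obtain \<sigma> where \<sigma>: "\<forall>f\<in>F. dp_value ring_of_type_algebra ex ey \<iota> \<sigma> f = 0"
      "dp_value ring_of_type_algebra ex ey \<iota> \<sigma> g \<noteq> 0"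
    using F(2) by (auto simp: dp_solvable_def ring_of_type_algebra_def)
  have "dp_solvable ?E ?ex ?ey ?i F g"
    unfolding dp_solvable_def
    by (rule exI[of _ "\<lambda>i. j (\<sigma> i)"])
      (use \<sigma> j in \<open>auto simp: dp_value_image_ring E inj_eq\<close>)
  ultimately show ?thesis
    using closed F(1) unfolding differentially_closed_def by blast
qed

primrec dp_horner :: "'a::zero list \<Rightarrow> 'a diff_poly"
  where "dp_horner [] = Const 0"
  | "dp_horner (u # us) = Plus (Const u) (Times (Ind 0) (dp_horner us))"

lemma dp_value_horner:
  fixes \<iota> :: "'a::comm_ring_1 \<Rightarrow> 'b::field"
  assumes "\<iota> 0 = 0"
  shows "dp_value ring_of_type_algebra ex ey \<iota> \<sigma> (dp_horner us)
    = poly (map_poly \<iota> (Poly us)) (\<sigma> 0)"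
  using assms by (induction us) (simp_all add: map_poly_pCons ring_of_type_algebra_def)

lemma poly_map_Fract_X:
  "poly (map_poly (\<lambda>u. Fract [:u:] 1) p) (Fract [:0, 1:] 1) = Fract (p :: 'a::idom poly) 1"
proof (induction p)
  case (pCons u p)
  then show ?case
    by (simp add: map_poly_pCons Zero_fract_def)
qed (simp add: Zero_fract_def)

text \<open>The compatibility hypothesis is \<open>t\<^sub>x\<^sub>y = t\<^sub>y\<^sub>x\<close>, expanded by the chain rule and read as an identity
  of polynomials in \<open>t\<close>.  It makes \<open>K(T)\<close> with \<open>T\<^sub>x = P\<close>, \<open>T\<^sub>y = Q\<close> a differential field, in which
  \<open>T\<close> is a nonzero solution.\<close>

lemma polynomial_system_solvable:
  fixes dx dy :: "'a::field_char_0 \<Rightarrow> 'a"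
  assumes K: "differential_field dx dy" and closed: "differentially_closed dx dy"
    and compatible: "map_poly dx Q + pderiv Q * P = map_poly dy P + pderiv P * Q"
  obtains t where "t \<noteq> 0" "dx t = poly P t" "dy t = poly Q t"
proof -
  interpret differential_field dx dy by fact
  have dx: "derivation dx" and dy: "derivation dy"
    by (simp_all add: derivation_def dx_add dx_mult dy_add dy_mult)
  define ex ey where "ex = fract_derivation (poly_derivation dx P)"
    and "ey = fract_derivation (poly_derivation dy Q)"
  define \<iota> where "\<iota> = (\<lambda>u::'a. Fract [:u:] 1)"
  define T :: "'a poly fract" where "T = Fract [:0, 1:] 1"
  note pd = derivation_poly_derivation[OF dx, of P] derivation_poly_derivation[OF dy, of Q]
  have e: "derivation ex" "derivation ey"
    unfolding ex_def ey_def by (intro derivation_fract_derivation pd)+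
  have comm: "ex (ey x) = ey (ex x)" for x
    unfolding ex_def ey_def
    by (intro fract_derivations_commute poly_derivations_commute pd dx dy dx_dy_commute)
      (simp add: poly_derivation_def compatible)
  have \<iota>: "\<iota> (u + v) = \<iota> u + \<iota> v" "\<iota> (u * v) = \<iota> u * \<iota> v" "\<iota> 1 = 1" "\<iota> 0 = 0"
    "\<iota> (dx u) = ex (\<iota> u)" "\<iota> (dy u) = ey (\<iota> u)" for u v
    by (simp_all add: \<iota>_def ex_def ey_def One_fract_def Zero_fract_def pCons_one mult.commute
        fract_derivation_embed pd derivation.zero[OF dx] derivation.zero[OF dy])
  have T: "T \<noteq> 0" "ex T = Fract P 1" "ey T = Fract Q 1"
    by (simp_all add: T_def ex_def ey_def Zero_fract_def eq_fract fract_derivation_embed pd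
        poly_derivation_X dx dy)
  define minus_rhs where "minus_rhs e R = Plus e (Times (Const (-1)) (dp_horner (coeffs R)))"
    for e and R :: "'a poly"
  define F where "F = {minus_rhs (DerivX (Ind 0)) P, minus_rhs (DerivY (Ind 0)) Q}"
  obtain j :: "'a poly fract \<Rightarrow> 'a" where j: "inj j"
    by (rule rational_functions_embed)
  have "dp_solvable ring_of_type_algebra dx dy id F (Ind 0)"
  proof (rule differentially_closed_solvable[OF closed j e comm, of \<iota>])
    have m1: "\<iota> (- 1) = - 1"
      using \<iota>(1)[of "- 1" 1] \<iota>(3,4) by (simp add: eq_neg_iff_add_eq_0)
    have "dp_value ring_of_type_algebra ex ey \<iota> (\<lambda>_. T) (dp_horner (coeffs R)) = Fract R 1" for R
      by (subst dp_value_horner) (simp_all add: \<iota> Poly_coeffs, simp add: \<iota>_def T_def poly_map_Fract_X)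
    moreover have "Fract 0 1 = (0 :: 'a poly fract)"
      by (simp add: Zero_fract_def)
    ultimately show "dp_solvable ring_of_type_algebra ex ey \<iota> F (Ind 0)"
      unfolding dp_solvable_def
      by (intro exI[of _ "\<lambda>_. T"]) (simp add: F_def minus_rhs_def ring_of_type_algebra_def T m1)
  qed (simp_all add: \<iota> F_def)
  then obtain \<sigma> where "\<forall>f\<in>F. dp_value ring_of_type_algebra dx dy id \<sigma> f = 0" "\<sigma> 0 \<noteq> 0"
    by (auto simp: dp_solvable_def ring_of_type_algebra_def)
  then have "\<sigma> 0 \<noteq> 0" "dx (\<sigma> 0) = poly P (\<sigma> 0)" "dy (\<sigma> 0) = poly Q (\<sigma> 0)"
    by (simp_all add: F_def minus_rhs_def dp_value_horner)
      (simp_all add: ring_of_type_algebra_def)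
  then show thesis by (rule that)
qed

section \<open>The parameter and the integrability conditions\<close>

text \<open>With \<open>p = q\<^sub>y / q\<close> and \<open>U = (I\<^sub>3 - I\<^sub>2) / q\<close> these are the equations \<open>I\<^sub>2 = - p\<^sub>x\<close> and
  \<open>U\<^sub>x + p I\<^sub>3 + (I\<^sub>3)\<^sub>y = 0\<close>, which express that the Riccati system
  \<open>A\<^sub>x = - I\<^sub>3 - q A\<^sup>2 / 2\<close>, \<open>A\<^sub>y = U - p A + A\<^sup>2 / 2\<close> for \<open>A = z\<^sub>x\<^sub>y / z\<^sub>x\<close> is compatible: they are the
  coefficients, up to sign, of \<open>A\<close> and of \<open>1\<close> in \<open>A\<^sub>x\<^sub>y - A\<^sub>y\<^sub>x\<close>, and the others cancel.\<close>

definition integrability_conditions ::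
  "('a::field_char_0 \<Rightarrow> 'a) \<Rightarrow> ('a \<Rightarrow> 'a) \<Rightarrow> 'a \<Rightarrow> 'a \<Rightarrow> 'a \<Rightarrow> bool"
  where "integrability_conditions dx dy q I2 I3 \<longleftrightarrow>
    I2 = - dx (dy q / q) \<and> dx ((I3 - I2) / q) + (dy q / q) * I3 + dy I3 = 0"

context differential_field
begin

lemma derivation_dx: "derivation dx" and derivation_dy: "derivation dy"
  by (simp_all add: derivation_def dx_add dx_mult dy_add dy_mult)

sublocale dx: derivation dx by (rule derivation_dx)
sublocale dy: derivation dy by (rule derivation_dy)

lemmas deriv_simps = dx_add dx_mult dy_add dy_mult dx.minus dy.minus dx.diff dy.diff
  dx_dy_commute

lemma deriv_half: "dx (u / 2) = dx u / 2" "dy (u / 2) = dy u / 2"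
  using derivation_divide[OF derivation_dx, of 2 u] derivation_divide[OF derivation_dy, of 2 u]
  by simp_all

text \<open>The system for \<open>z\<close> is triangular in \<open>A = z\<^sub>x\<^sub>y / z\<^sub>x\<close>, \<open>w = z\<^sub>y\<close> and \<open>z\<close>.  Substituting
  \<open>z\<^sub>x\<^sub>y / z\<^sub>y = - q A\<close> into the formulas for the invariants gives the Riccati system for \<open>A\<close>; given
  \<open>A\<close>, the equation \<open>z\<^sub>x = - q w\<close> and its derivative with respect to \<open>y\<close> give linear systems for
  \<open>w\<close> and \<open>z\<close>.  Each of the three has one unknown and is solved within \<open>K\<close> before the next.\<close>

lemma parameter_of_integrability:
  assumes closed: "differentially_closed dx dy"
    and q: "q \<noteq> 0" and C: "integrability_conditions dx dy q I2 I3"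
  obtains z where "dx z \<noteq> 0" "dy z \<noteq> 0" "q = - (dx z / dy z)"
    "I2 = dy (dy (dx z) / dy z) - dx (dy (dx z) / dx z)"
    "I3 = - dx (dy (dx z) / dx z) + (dy (dx z) / dx z) * (dy (dx z) / dy z) / 2"
proof -
  note solve = polynomial_system_solvable[OF differential_field_axioms closed]
  note poly_simps = map_poly_pCons pderiv_pCons
  define p U where "p = dy q / q" and "U = (I3 - I2) / q"
  have qy: "dy q = p * q" and I3: "I3 = q * U + I2"
    using q by (simp_all add: p_def U_def)
  have I2: "I2 = - dx p" and "dx U + (p * I3 + dy I3) = 0"
    using C unfolding integrability_conditions_def p_def U_def by (auto simp only: add.assoc)
  then have Ux: "dx U = - (p * I3 + dy I3)"
    by (simp only: eq_neg_iff_add_eq_0)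
  \<comment> \<open>The conditions say precisely that the mixed derivatives of a solution \<open>A\<close> agree.\<close>
  obtain A where Ax: "dx A = - I3 - q * A\<^sup>2 / 2" and Ay: "dy A = U - p * A + A\<^sup>2 / 2"
  proof (rule solve[of "[:U, - p, 1 / 2:]" "[:- I3, 0, - (q * (1 / 2)):]"])
    show "map_poly dx [:U, - p, 1 / 2:] + pderiv [:U, - p, 1 / 2:] * [:- I3, 0, - (q * (1 / 2)):]
      = map_poly dy [:- I3, 0, - (q * (1 / 2)):] + pderiv [:- I3, 0, - (q * (1 / 2)):] * [:U, - p, 1 / 2:]"
      by (simp add: poly_simps deriv_simps deriv_half qy Ux I2 I3 field_simps)
  qed (simp add: power2_eq_square algebra_simps)
  \<comment> \<open>The linear system comes from \<open>w\<^sub>x = z\<^sub>x\<^sub>y = - q A w\<close> and \<open>z\<^sub>x\<^sub>y = (z\<^sub>x)\<^sub>y = - (q w)\<^sub>y\<close>.\<close>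
  obtain w where w: "w \<noteq> 0" and wx: "dx w = - q * A * w" and wy: "dy w = (A - p) * w"
  proof (rule solve[of "[:0, A - p:]" "[:0, - q * A:]"])
    show "map_poly dx [:0, A - p:] + pderiv [:0, A - p:] * [:0, - q * A:]
      = map_poly dy [:0, - q * A:] + pderiv [:0, - q * A:] * [:0, A - p:]"
      by (simp add: poly_simps deriv_simps qy Ax Ay I2 I3 field_simps power2_eq_square)
  qed (simp add: algebra_simps)
  obtain z where zx: "dx z = - q * w" and zy: "dy z = w"
  proof (rule solve[of "[:w:]" "[:- q * w:]"])
    show "map_poly dx [:w:] + pderiv [:w:] * [:- q * w:]
      = map_poly dy [:- q * w:] + pderiv [:- q * w:] * [:w:]"
      by (simp add: poly_simps deriv_simps qy wx wy algebra_simps)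
  qed simp
  have zxy: "dy (dx z) = - q * A * w"
    using wx by (simp add: dx_dy_commute[symmetric] zy)
  have A: "dy (dx z) / dx z = A" and B: "dy (dx z) / dy z = - (q * A)"
    using q w zy by (simp_all add: zxy) (simp_all add: zx)
  show thesis
  proof
    show "dx z \<noteq> 0" "dy z \<noteq> 0" "q = - (dx z / dy z)"
      using q w by (simp_all add: zx zy)
    show "I2 = dy (dy (dx z) / dy z) - dx (dy (dx z) / dx z)"
      unfolding A B by (simp add: deriv_simps qy Ax Ay I3 field_simps power2_eq_square)
    show "I3 = - dx (dy (dx z) / dx z) + (dy (dx z) / dx z) * (dy (dx z) / dy z) / 2"
      unfolding A B by (simp add: Ax power2_eq_square)
  qed
qed

text \<open>The logarithmic derivatives of \<open>w = z\<^sub>y\<close> are \<open>- q A\<close> and \<open>A - p\<close>.  Equality of the mixed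
  derivatives of \<open>w\<close> gives \<open>p\<^sub>x = A\<^sub>x + (q A)\<^sub>y\<close>, which is the first condition.  As \<open>I\<^sub>3\<close> and \<open>U\<close> are
  now polynomials in \<open>A\<close>, \<open>q\<close>, \<open>p\<close> and their derivatives, the second one is a computation.\<close>

lemma integrability_of_parameter:
  assumes z: "dx z \<noteq> 0" "dy z \<noteq> 0" and q: "q = - (dx z / dy z)"
    and I2: "I2 = dy (dy (dx z) / dy z) - dx (dy (dx z) / dx z)"
    and I3: "I3 = - dx (dy (dx z) / dx z) + (dy (dx z) / dx z) * (dy (dx z) / dy z) / 2"
  shows "integrability_conditions dx dy q I2 I3"
proof -
  define A where "A = dy (dx z) / dx z"
  define p where "p = dy q / q"
  have q0: "q \<noteq> 0" using z q by simp
  have zx: "dx z = - q * dy z" using z q by simp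
  have B: "dy (dx z) / dy z = - (q * A)"
    using z by (simp add: A_def q)
  have qy: "dy q = p * q" using q0 by (simp add: p_def)
  have wx: "dx (dy z) = - (q * A) * dy z"
    using z B by (simp add: field_simps dx_dy_commute)
  have "dy (dx z) = - p * q * dy z - q * dy (dy z)"
    by (simp add: zx deriv_simps qy algebra_simps)
  then have "q * dy (dy z) = q * ((A - p) * dy z)"
    using wx by (simp add: dx_dy_commute algebra_simps)
  then have wy: "dy (dy z) = (A - p) * dy z"
    using q0 by simp
  have "dx (dy (dy z)) = dy (dx (dy z))"
    by (rule dx_dy_commute)
  then have "dy z * (dx A - dx p) = dy z * - (dy q * A + q * dy A)"
    unfolding wx wy by (simp add: deriv_simps wx[unfolded dx_dy_commute] wy algebra_simps)
  then have "dx A - dx p = - (dy q * A + q * dy A)"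
    using z mult_left_cancel by blast
  then have px: "dx p = dx A + dy q * A + q * dy A"
    by (simp add: algebra_simps)
  have I2': "I2 = - dx p"
    unfolding I2 B A_def[symmetric] px by (simp add: deriv_simps)
  have I3': "I3 = - dx A - q * A\<^sup>2 / 2"
    unfolding I3 B A_def[symmetric] by (simp add: power2_eq_square)
  have U: "(I3 - I2) / q = dy A + p * A - A\<^sup>2 / 2"
    using q0 by (simp add: I2' I3' px qy field_simps power2_eq_square)
  have "dx (dy A + p * A - A\<^sup>2 / 2) + p * I3 + dy I3 = 0"
    unfolding I3' by (simp add: deriv_simps deriv_half px qy power2_eq_square field_simps)
  then show ?thesis
    unfolding integrability_conditions_def U using I2' by (simp add: p_def)
qed

end

section \<open>Composition and symbols of operators\<close>

abbreviation "single \<equiv> Poly_Mapping.single"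
abbreviation "lookup \<equiv> Poly_Mapping.lookup"
abbreviation "keys \<equiv> Poly_Mapping.keys"

definition degree_at_most :: "nat \<Rightarrow> 'a::zero pdo \<Rightarrow> bool"
  where "degree_at_most n P \<longleftrightarrow> (\<forall>i j. lookup P (i, j) \<noteq> 0 \<longrightarrow> i + j \<le> n)"

text \<open>The composition of the monomial operators \<open>u D\<^sup>m\<close> and \<open>v D\<^sup>n\<close>, where \<open>m\<close> and \<open>n\<close> are pairs of
  exponents.\<close>

definition term_comp ::
  "('a::field_char_0 \<Rightarrow> 'a) \<Rightarrow> ('a \<Rightarrow> 'a) \<Rightarrow> nat \<times> nat \<Rightarrow> 'a \<Rightarrow> nat \<times> nat \<Rightarrow> 'a \<Rightarrow> 'a pdo"
  where "term_comp dx dy m u n v = (\<Sum>s\<le>fst m. \<Sum>t\<le>snd m.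
    single (fst m - s + fst n, snd m - t + snd n)
      (u * of_nat (fst m choose s) * of_nat (snd m choose t) * (dx ^^ s) ((dy ^^ t) v)))"

lemma pdo_comp_eq_term_comp:
  "pdo_comp dx dy P Q
    = (\<Sum>m\<in>keys P. \<Sum>n\<in>keys Q. term_comp dx dy m (lookup P m) n (lookup Q n))"
  by (simp add: pdo_comp_def term_comp_def case_prod_beta)

context differential_field
begin

lemma iterate_zero: "(dx ^^ s) ((dy ^^ t) 0) = 0"
proof -
  have "(dy ^^ t) 0 = 0" by (induction t) simp_all
  moreover have "(dx ^^ s) 0 = 0" by (induction s) simp_all
  ultimately show ?thesis by simp
qed

lemma iterate_add: "(dx ^^ s) ((dy ^^ t) (u + v)) = (dx ^^ s) ((dy ^^ t) u) + (dx ^^ s) ((dy ^^ t) v)"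
proof -
  have "(dy ^^ t) (u + v) = (dy ^^ t) u + (dy ^^ t) v" for u v
    by (induction t) (simp_all add: dy_add)
  moreover have "(dx ^^ s) (u + v) = (dx ^^ s) u + (dx ^^ s) v" for u v
    by (induction s) (simp_all add: dx_add)
  ultimately show ?thesis by simp
qed

lemma term_comp_zero [simp]: "term_comp dx dy m 0 n v = 0" "term_comp dx dy m u n 0 = 0"
  by (simp_all add: term_comp_def iterate_zero)

lemma term_comp_add:
  "term_comp dx dy m (u + u') n v = term_comp dx dy m u n v + term_comp dx dy m u' n v"
  "term_comp dx dy m u n (v + v') = term_comp dx dy m u n v + term_comp dx dy m u n v'"
  by (simp_all add: term_comp_def iterate_add single_add sum.distrib algebra_simps)

text \<open>Summing over finite supersets of the keys brings sums of operators to common index sets, from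
  which biadditivity of the composition follows.\<close>

lemma pdo_comp_superset:
  assumes "finite A" "keys P \<subseteq> A" "finite B" "keys Q \<subseteq> B"
  shows "pdo_comp dx dy P Q = (\<Sum>m\<in>A. \<Sum>n\<in>B. term_comp dx dy m (lookup P m) n (lookup Q n))"
proof -
  have "(\<Sum>n\<in>keys Q. term_comp dx dy m (lookup P m) n (lookup Q n))
      = (\<Sum>n\<in>B. term_comp dx dy m (lookup P m) n (lookup Q n))" for m
    by (rule sum.mono_neutral_left) (use assms in \<open>auto simp: in_keys_iff\<close>)
  then show ?thesis
    unfolding pdo_comp_eq_term_comp
    by (simp, intro sum.mono_neutral_left) (use assms in \<open>auto simp: in_keys_iff\<close>)
qed

lemma pdo_comp_single: "pdo_comp dx dy (single m u) (single n v) = term_comp dx dy m u n v"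
  by (subst pdo_comp_superset[where A = "{m}" and B = "{n}"]) (auto split: if_splits)

lemma pdo_comp_add_left:
  "pdo_comp dx dy (P + P') Q = pdo_comp dx dy P Q + pdo_comp dx dy P' Q"
proof -
  have "keys (P + P') \<subseteq> keys P \<union> keys P'" by (rule keys_add)
  then show ?thesis
    by (simp add: pdo_comp_superset[where A = "keys P \<union> keys P'" and B = "keys Q"]
        lookup_add term_comp_add sum.distrib)
qed

lemma pdo_comp_add_right:
  "pdo_comp dx dy P (Q + Q') = pdo_comp dx dy P Q + pdo_comp dx dy P Q'"
proof -
  have "keys (Q + Q') \<subseteq> keys Q \<union> keys Q'" by (rule keys_add)
  then show ?thesis
    by (simp add: pdo_comp_superset[where A = "keys P" and B = "keys Q \<union> keys Q'"]
        lookup_add term_comp_add sum.distrib)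
qed

lemma degree_pdo_comp:
  assumes "degree_at_most k P" "degree_at_most l Q"
  shows "degree_at_most (k + l) (pdo_comp dx dy P Q)"
  unfolding degree_at_most_def
proof (intro allI impI, rule ccontr)
  fix i j
  assume nz: "lookup (pdo_comp dx dy P Q) (i, j) \<noteq> 0" and ij: "\<not> i + j \<le> k + l"
  have "lookup (term_comp dx dy m (lookup P m) n (lookup Q n)) (i, j) = 0"
    if "m \<in> keys P" "n \<in> keys Q" for m n
  proof -
    have "fst m + snd m \<le> k" "fst n + snd n \<le> l"
      using assms that by (cases m; cases n; simp add: degree_at_most_def in_keys_iff)+
    with ij have "(fst m - s + fst n, snd m - t + snd n) \<noteq> (i, j)" for s t
      by auto
    then show ?thesis
      unfolding term_comp_def lookup_sum by (intro sum.neutral ballI lookup_single_not_eq)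
  qed
  with nz show False
    by (simp add: pdo_comp_eq_term_comp lookup_sum)
qed

lemma iterate_one: "(dx ^^ s) ((dy ^^ t) 1) = (if s = 0 \<and> t = 0 then 1 else 0)"
proof -
  have "(dy ^^ t) 1 = (if t = 0 then 1 else 0)"
    by (induction t) simp_all
  moreover have "(dx ^^ s) 1 = (if s = 0 then 1 else 0)"
    by (induction s) simp_all
  moreover have "(dx ^^ s) 0 = 0"
    by (induction s) simp_all
  ultimately show ?thesis by simp
qed

text \<open>All derivatives of the coefficient \<open>1\<close> vanish, so composing with a pure monomial from the right
  only shifts the exponents.\<close>

lemma lookup_pdo_comp_monomial:
  "lookup (pdo_comp dx dy P (single (k, l) 1)) (i + k, j + l) = lookup P (i, j)"
proof -
  have one_right: "term_comp dx dy m u n 1 = single (fst m + fst n, snd m + snd n) u" for m n u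
  proof -
    have "term_comp dx dy m u n 1 = (\<Sum>s\<le>fst m. \<Sum>t\<le>snd m. if t = 0 then
        (if s = 0 then single (fst m + fst n, snd m + snd n) u else 0) else 0)"
      unfolding term_comp_def by (intro sum.cong refl) (auto simp: iterate_one)
    then show ?thesis by simp
  qed
  have "pdo_comp dx dy P (single (k, l) 1) = (\<Sum>m\<in>keys P. single (fst m + k, snd m + l) (lookup P m))"
    by (simp add: pdo_comp_eq_term_comp one_right)
  also have "lookup \<dots> (i + k, j + l) = (\<Sum>m\<in>keys P. if m = (i, j) then lookup P m else 0)"
    unfolding lookup_sum by (intro sum.cong refl) (auto simp: lookup_single when_def)
  also have "\<dots> = lookup P (i, j)"
    by (simp add: in_keys_iff)
  finally show ?thesis .
qed

end

lemma lookup_Sym: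
  "lookup (Sym P) (i, j) = (if i + j = pdo_order P then lookup P (i, j) else 0)"
proof -
  have fin: "finite {(i, j) \<in> keys P. i + j = pdo_order P}"
    by (rule finite_subset[of _ "keys P"]) auto
  have "Sym P = (\<Sum>m\<in>{(i, j) \<in> keys P. i + j = pdo_order P}. single m (lookup P m))"
    unfolding Sym_def by (intro sum.cong refl) auto
  then have "lookup (Sym P) (i, j)
    = (\<Sum>m\<in>{(i, j) \<in> keys P. i + j = pdo_order P}. if m = (i, j) then lookup P m else 0)"
    by (simp add: lookup_sum lookup_single when_def)
  then show ?thesis
    using fin by (auto simp: in_keys_iff)
qed

lemma degree_pdo_order: "degree_at_most (pdo_order P) P"
  unfolding degree_at_most_def
proof (intro allI impI)
  fix i j
  assume "lookup P (i, j) \<noteq> 0"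
  then have "(i, j) \<in> keys P" by (simp add: in_keys_iff)
  then have "i + j \<in> (\<lambda>(i, j). i + j) ` keys P" by force
  moreover have "P \<noteq> 0" using \<open>lookup P (i, j) \<noteq> 0\<close> by auto
  ultimately show "i + j \<le> pdo_order P"
    unfolding pdo_order_def by simp
qed

lemma pdo_order_eqI:
  assumes "degree_at_most (i + j) P" "lookup P (i, j) \<noteq> 0"
  shows "pdo_order P = i + j"
proof -
  have "P \<noteq> 0" using assms by auto
  have "Max ((\<lambda>(i, j). i + j) ` keys P) = i + j"
    by (rule Max_eqI) (use assms in \<open>force simp: degree_at_most_def in_keys_iff\<close>)+
  then show ?thesis using \<open>P \<noteq> 0\<close> by (simp add: pdo_order_def)
qed

lemma lookup_L_op:
  "lookup (L_op a b c) n = (if n = (1, 1) then 1 else if n = (1, 0) then a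
    else if n = (0, 1) then b else if n = (0, 0) then c else 0)"
  by (auto simp: L_op_def lookup_add lookup_single when_def)

lemma Sym_eq_Sym_L_op_iff:
  "Sym L' = Sym (L_op a b c) \<longleftrightarrow> (\<exists>a' b' c'. L' = L_op a' b' c')"
proof -
  have deg: "degree_at_most (1 + 1) (L_op a b c)" for a b c :: 'a
    by (auto simp: degree_at_most_def lookup_L_op split: if_splits)
  have ord: "pdo_order (L_op a b c) = 2" for a b c :: 'a
    using pdo_order_eqI[OF deg] by (simp add: lookup_L_op)
  have sym: "lookup (Sym (L_op a b c)) n = (if n = (1, 1) then 1 else 0)" for a b c :: 'a and n
    by (cases n) (simp add: lookup_Sym ord lookup_L_op)
  show ?thesis
  proof
    assume eq: "Sym L' = Sym (L_op a b c)"
    then have top: "lookup (Sym L') (i, j) = (if (i, j) = (1, 1) then 1 else 0)" for i j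
      by (simp add: sym)
    from top[of 1 1] have ord': "pdo_order L' = 2"
      by (simp add: lookup_Sym split: if_splits)
    have "L' = L_op (lookup L' (1, 0)) (lookup L' (0, 1)) (lookup L' (0, 0))"
    proof (rule poly_mapping_eqI)
      fix n :: "nat \<times> nat"
      obtain i j where n: "n = (i, j)" by (cases n)
      consider "i + j > 2" | "i + j = 2" | "i + j \<le> 1" by linarith
      then show "lookup L' n = lookup (L_op (lookup L' (1, 0)) (lookup L' (0, 1)) (lookup L' (0, 0))) n"
      proof cases
        case 1
        then have "lookup L' (i, j) = 0"
          using degree_pdo_order[of L'] ord' by (force simp: degree_at_most_def)
        then show ?thesis using 1 n by (auto simp: lookup_L_op)
      next
        case 2
        then show ?thesis using top[of i j] n ord' by (auto simp: lookup_Sym lookup_L_op)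
      next
        case 3
        then have "(i, j) \<in> {(0, 0), (1, 0), (0, 1)}" by (cases i; cases j) auto
        then show ?thesis using n by (auto simp: lookup_L_op)
      qed
    qed
    then show "\<exists>a' b' c'. L' = L_op a' b' c'" by blast
  next
    assume "\<exists>a' b' c'. L' = L_op a' b' c'"
    then obtain a' b' c' where L': "L' = L_op a' b' c'" by blast
    show "Sym L' = Sym (L_op a b c)"
      by (rule poly_mapping_eqI) (simp add: L' sym)
  qed
qed

context differential_field
begin

section \<open>Darboux transformations in coordinates\<close>

lemma pdo_comp_first_order_L_op:
  "pdo_comp dx dy (single (1, 0) n1 + single (0, 1) n2 + single (0, 0) n0) (L_op a b c)
    = single (2, 1) n1 + single (1, 2) n2 + single (2, 0) (n1 * a) + single (0, 2) (n2 * b)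
      + single (1, 1) (n1 * b + n2 * a + n0)
      + single (1, 0) (n1 * (c + dx a) + n2 * dy a + n0 * a)
      + single (0, 1) (n1 * dx b + n2 * (c + dy b) + n0 * b)
      + single (0, 0) (n1 * dx c + n2 * dy c + n0 * c)"
  unfolding L_op_def
  by (rule poly_mapping_eqI)
    (simp add: pdo_comp_add_left pdo_comp_add_right pdo_comp_single term_comp_def
      lookup_add lookup_single when_def numeral_2_eq_2 algebra_simps)

lemma pdo_comp_L_op_M_op:
  "pdo_comp dx dy (L_op a b c) (M_op q r)
    = single (2, 1) 1 + single (1, 2) q + single (2, 0) a + single (0, 2) (dx q + b * q)
      + single (1, 1) (dy q + r + a * q + b)
      + single (1, 0) (dy r + a * r + c)
      + single (0, 1) (dy (dx q) + dx r + a * dx q + b * dy q + b * r + c * q)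
      + single (0, 0) (dy (dx r) + a * dx r + b * dy r + c * r)"
  unfolding L_op_def M_op_def
  by (rule poly_mapping_eqI)
    (simp add: pdo_comp_add_left pdo_comp_add_right pdo_comp_single term_comp_def dx_dy_commute
      lookup_add lookup_single when_def numeral_2_eq_2 algebra_simps)

lemma cubic_eq_iff:
  "single (2, 1) u1 + single (1, 2) u2 + single (2, 0) u3 + single (0, 2) u4
      + single (1, 1) u5 + single (1, 0) u6 + single (0, 1) u7 + single (0, 0) u8
    = single (2, 1) v1 + single (1, 2) v2 + single (2, 0) v3 + single (0, 2) v4
      + single (1, 1) v5 + single (1, 0) v6 + single (0, 1) v7 + single (0 :: nat, 0 :: nat) (v8 :: 'a)
    \<longleftrightarrow> u1 = v1 \<and> u2 = v2 \<and> u3 = v3 \<and> u4 = v4 \<and> u5 = v5 \<and> u6 = v6 \<and> u7 = v7 \<and> u8 = v8"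
  (is "?P = ?Q \<longleftrightarrow> ?R")
proof
  assume "?P = ?Q"
  then have "lookup ?P n = lookup ?Q n" for n by simp
  from this[of "(2, 1)"] this[of "(1, 2)"] this[of "(2, 0)"] this[of "(0, 2)"] this[of "(1, 1)"]
    this[of "(1, 0)"] this[of "(0, 1)"] this[of "(0, 0)"]
  show ?R by (simp add: lookup_add lookup_single when_def)
qed simp

text \<open>If \<open>N\<close> had order \<open>d \<ge> 2\<close>, each of its top terms would reappear in \<open>N \<circ> L\<close>, shifted by
  \<open>D\<^sub>xD\<^sub>y\<close>, in degree \<open>d + 2 \<ge> 4\<close>, where the other side has nothing.\<close>

lemma left_factor_first_order:
  assumes eq: "pdo_comp dx dy N (L_op a b c) = pdo_comp dx dy (L_op a' b' c') (M_op q r)"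
  shows "N = single (1, 0) (lookup N (1, 0)) + single (0, 1) (lookup N (0, 1))
    + single (0, 0) (lookup N (0, 0))"
proof -
  let ?d = "pdo_order N"
  have deg_N: "degree_at_most ?d N" by (rule degree_pdo_order)
  have low: "degree_at_most 1 (single (1, 0) a + single (0, 1) b + single (0, 0) c)"
    by (auto simp: degree_at_most_def lookup_add lookup_single when_def split: if_splits)
  have L: "L_op a b c = single (1, 1) 1 + (single (1, 0) a + single (0, 1) b + single (0, 0) c)"
    by (simp add: L_op_def add.assoc)
  have deg_rhs: "degree_at_most 3 (pdo_comp dx dy (L_op a' b' c') (M_op q r))"
    using degree_pdo_comp[of 2 "L_op a' b' c'" 1 "M_op q r"]
    by (auto simp: degree_at_most_def lookup_L_op M_op_def lookup_add lookup_single when_def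
        split: if_splits)
  have zero: "lookup N (i, j) = 0" if "i + j = ?d" "?d \<ge> 2" for i j
  proof -
    have "lookup (pdo_comp dx dy N (L_op a b c)) (i + 1, j + 1) = lookup N (i, j)
        + lookup (pdo_comp dx dy N (single (1, 0) a + single (0, 1) b + single (0, 0) c)) (i + 1, j + 1)"
      unfolding L pdo_comp_add_right[of N "single (1, 1) 1"] lookup_add
      by (simp only: lookup_pdo_comp_monomial)
    moreover have "lookup (pdo_comp dx dy N (single (1, 0) a + single (0, 1) b + single (0, 0) c))
        (i + 1, j + 1) = 0"
      using degree_pdo_comp[OF deg_N low] that
      unfolding degree_at_most_def by force
    moreover have "lookup (pdo_comp dx dy (L_op a' b' c') (M_op q r)) (i + 1, j + 1) = 0"
      using deg_rhs that unfolding degree_at_most_def by force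
    ultimately show ?thesis using eq by simp
  qed
  have "?d \<le> 1"
  proof (rule ccontr)
    assume d: "\<not> ?d \<le> 1"
    then have "N \<noteq> 0" by (auto simp: pdo_order_def)
    then have "?d \<in> (\<lambda>(i, j). i + j) ` keys N"
      unfolding pdo_order_def by (simp only: if_False) (intro Max_in, auto)
    then obtain i j where "(i, j) \<in> keys N" "i + j = ?d"
      by auto
    with zero[of i j] d show False by (simp add: in_keys_iff)
  qed
  show ?thesis
  proof (rule poly_mapping_eqI)
    fix n :: "nat \<times> nat"
    obtain i j where n: "n = (i, j)" by (cases n)
    show "lookup N n = lookup (single (1, 0) (lookup N (1, 0)) + single (0, 1) (lookup N (0, 1))
      + single (0, 0) (lookup N (0, 0))) n"
    proof (cases "i + j \<le> 1")
      case True
      then have "(i, j) \<in> {(0, 0), (1, 0), (0, 1)}" by (cases i; cases j) auto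
      then show ?thesis using n by (auto simp: lookup_add lookup_single when_def)
    next
      case False
      then have "lookup N (i, j) = 0"
        using deg_N \<open>?d \<le> 1\<close> unfolding degree_at_most_def by force
      then show ?thesis using False n by (auto simp: lookup_add lookup_single when_def)
    qed
  qed
qed

text \<open>With \<open>N\<close> and \<open>L\<^sub>1\<close> having three unknown coefficients each, the eight coefficients of
  \<open>N \<circ> L = L\<^sub>1 \<circ> M\<close> form a triangular system: those of order three and two and that of \<open>D\<^sub>x\<close> determine the
  unknowns, and those of \<open>D\<^sub>y\<close> and of \<open>1\<close> remain as conditions on \<open>L\<close> and \<open>M\<close>.\<close>

lemma darboux_transformation_exists_iff_equations:
  fixes a b c q r :: 'a
  assumes q: "q \<noteq> 0"
  defines "l \<equiv> dx q / q"
  defines "n \<equiv> dy q + r - l"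
  defines "c' \<equiv> c + dx a + q * dy a + n * a - dy r - a * r"
  shows "darboux_transformation_exists dx dy (L_op a b c) (M_op q r) \<longleftrightarrow>
    dx b + q * (c + dy b) + n * b = dy (dx q) + dx r + a * dx q + (b - l) * dy q + (b - l) * r + c' * q
    \<and> dx c + q * dy c + n * c = dy (dx r) + a * dx r + (b - l) * dy r + c' * r"
  (is "_ \<longleftrightarrow> ?E")
proof -
  have comp_eq_iff: "pdo_comp dx dy (single (1, 0) n1 + single (0, 1) n2 + single (0, 0) n0) (L_op a b c)
      = pdo_comp dx dy (L_op a1 b1 c1) (M_op q r)
    \<longleftrightarrow> n1 = 1 \<and> n2 = q \<and> n0 = n \<and> a1 = a \<and> b1 = b - l \<and> c1 = c' \<and> ?E" for n1 n2 n0 a1 b1 c1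
  proof -
    have "dx q = l * q" using q by (simp add: l_def)
    then have "q * b = dx q + b1 * q \<longleftrightarrow> q * b = q * (b1 + l)"
      by (simp add: algebra_simps)
    then have b1: "q * b = dx q + b1 * q \<longleftrightarrow> b1 = b - l"
      using q by (auto simp: eq_diff_eq)
    have "n1 = 1 \<and> n2 = q \<and> n1 * a = a1 \<and> n2 * b = dx q + b1 * q
        \<and> n1 * b + n2 * a + n0 = dy q + r + a1 * q + b1
        \<and> n1 * (c + dx a) + n2 * dy a + n0 * a = dy r + a1 * r + c1
      \<longleftrightarrow> n1 = 1 \<and> n2 = q \<and> n0 = n \<and> a1 = a \<and> b1 = b - l \<and> c1 = c'"
    proof -
      have n: "b + q * a + n0 = dy q + r + a * q + (b - l) \<longleftrightarrow> n0 = n"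
        by (auto simp: n_def algebra_simps)
      have c: "c + dx a + q * dy a + n * a = dy r + a * r + c1 \<longleftrightarrow> c1 = c'"
        by (auto simp: c'_def algebra_simps)
      show ?thesis
        using b1 n c by auto
    qed
    then show ?thesis
      unfolding pdo_comp_first_order_L_op pdo_comp_L_op_M_op cubic_eq_iff by auto
  qed
  show ?thesis
  proof
    assume "darboux_transformation_exists dx dy (L_op a b c) (M_op q r)"
    then obtain N a1 b1 c1 where
      "pdo_comp dx dy N (L_op a b c) = pdo_comp dx dy (L_op a1 b1 c1) (M_op q r)"
      by (auto simp: darboux_transformation_exists_def Sym_eq_Sym_L_op_iff)
    then show ?E
      using left_factor_first_order comp_eq_iff by metis
  next
    assume ?E
    then have "pdo_comp dx dy (single (1, 0) 1 + single (0, 1) q + single (0, 0) n) (L_op a b c)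
      = pdo_comp dx dy (L_op a (b - l) c') (M_op q r)"
      by (simp only: comp_eq_iff)
    then show "darboux_transformation_exists dx dy (L_op a b c) (M_op q r)"
      unfolding darboux_transformation_exists_def Sym_eq_Sym_L_op_iff by blast
  qed
qed

text \<open>The remaining coefficient equations \<open>E\<^sub>1 = 0\<close> and \<open>E\<^sub>0 = 0\<close> satisfy
  \<open>E\<^sub>1 = - q (I\<^sub>2 + p\<^sub>x)\<close> and \<open>2 E\<^sub>0 = - q (U\<^sub>x + p I\<^sub>3 + (I\<^sub>3)\<^sub>y) - (R + 2 q a) (I\<^sub>2 + p\<^sub>x)\<close>, so they are
  equivalent to the integrability conditions.  In the variables \<open>\<rho> = R / q\<close> and \<open>l = q\<^sub>x / q\<close> both
  identities become polynomial, the latter after its first bracket has been rewritten in terms of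
  \<open>I\<^sub>3 - I\<^sub>2 = q U\<close>.\<close>

lemma darboux_transformation_exists_iff_integrability_conditions:
  assumes q: "q \<noteq> 0"
  shows "darboux_transformation_exists dx dy (L_op a b c) (M_op q r) \<longleftrightarrow>
    integrability_conditions dx dy q (inv_I2 dx dy a b q r) (inv_I3 dx a b c q r)"
proof -
  define l where "l = dx q / q"
  define n where "n = dy q + r - l"
  define c' where "c' = c + dx a + q * dy a + n * a - dy r - a * r"
  define R where "R = inv_R a b q r"
  define \<rho> where "\<rho> = R / q"
  define I2 where "I2 = inv_I2 dx dy a b q r"
  define I3 where "I3 = inv_I3 dx a b c q r"
  define p where "p = dy q / q"
  define U where "U = (I3 - I2) / q"
  define E1 where "E1 = dx b + q * (c + dy b) + n * b
    - (dy (dx q) + dx r + a * dx q + (b - l) * dy q + (b - l) * r + c' * q)"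
  define E0 where "E0 = dx c + q * dy c + n * c - (dy (dx r) + a * dx r + (b - l) * dy r + c' * r)"
  have qx: "dx q = l * q" and R: "R = \<rho> * q"
    using q by (simp_all add: l_def \<rho>_def)
  have r: "r = \<rho> * q + b + q * a"
    using R by (simp add: R_def inv_R_def) (simp add: algebra_simps)
  have I2: "I2 = 2 * (dx a - dy b) - dy (\<rho> * q) + dx \<rho>"
    unfolding I2_def inv_I2_def inv_m_def R_def[symmetric] \<rho>_def[symmetric] R using q by simp
  have I3: "I3 = 2 * (a * b - c + dx a) + dx \<rho> - q * \<rho>\<^sup>2 / 2"
    unfolding I3_def inv_I3_def inv_h_def R_def[symmetric] \<rho>_def[symmetric] R
    using q by (simp add: power2_eq_square)
  \<comment> \<open>Both sides are the mixed second logarithmic derivative of \<open>q\<close>.\<close>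
  have px: "dx p = dy l"
    unfolding p_def l_def using q
    by (simp add: derivation_divide[OF derivation_dx] derivation_divide[OF derivation_dy] dx_dy_commute)
  have E1: "E1 = - q * (I2 + dx p)"
    unfolding E1_def c'_def n_def I2 px r by (simp add: deriv_simps qx algebra_simps)
  have qU: "I3 - I2 = q * U"
    using q by (simp add: U_def)
  have "dx (I3 - I2) = l * q * U + q * dx U"
    unfolding qU by (simp add: deriv_simps qx)
  then have "q * (dx U + p * I3 + dy I3)
    = dx (I3 - I2) - l * (I3 - I2) + dy q * I3 + q * dy I3"
    using q by (simp add: qU p_def algebra_simps)
  moreover have "2 * E0 = - (dx (I3 - I2) - l * (I3 - I2) + dy q * I3 + q * dy I3)
      - (R + 2 * q * a) * (I2 + dx p)"
    unfolding E0_def c'_def n_def I2 I3 px r R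
    by (simp add: deriv_simps deriv_half qx power2_eq_square field_simps)
  ultimately have E0: "2 * E0 = - q * (dx U + p * I3 + dy I3) - (R + 2 * q * a) * (I2 + dx p)"
    by simp
  have "darboux_transformation_exists dx dy (L_op a b c) (M_op q r) \<longleftrightarrow> E1 = 0 \<and> E0 = 0"
    unfolding darboux_transformation_exists_iff_equations[OF q] E1_def E0_def c'_def n_def l_def
    by simp
  also have "\<dots> \<longleftrightarrow> I2 + dx p = 0 \<and> dx U + p * I3 + dy I3 = 0"
    using E0 q by (auto simp: E1)
  also have "\<dots> \<longleftrightarrow> integrability_conditions dx dy q I2 I3"
    by (simp add: integrability_conditions_def p_def U_def eq_neg_iff_add_eq_0)
  finally show ?thesis by (simp add: I2_def I3_def)
qed

end

theorem theorem7p4: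
  fixes dx dy :: "'a::field_char_0 \<Rightarrow> 'a" and a b c q r :: 'a
  assumes "differential_field dx dy"
    and "differentially_closed dx dy"
    and "q \<noteq> 0"
  shows "(darboux_transformation_exists dx dy (L_op a b c) (M_op q r) \<longleftrightarrow>
      (\<exists>z. dx z \<noteq> 0 \<and> dy z \<noteq> 0 \<and> invariants_given_by dx dy a b c q r z))
    \<and> (\<forall>z. dx z \<noteq> 0 \<and> dy z \<noteq> 0 \<and> invariants_given_by dx dy a b c q r z
         \<and> dy (dx z) \<noteq> 0 \<longrightarrow>
         q = - ((dy (dx z) / dy z) / (dy (dx z) / dx z)))"
proof -
  interpret differential_field dx dy by fact
  show ?thesis
    unfolding darboux_transformation_exists_iff_integrability_conditions[OF assms(3)]
      invariants_given_by_def Let_def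
    by (auto intro: integrability_of_parameter elim!: parameter_of_integrability[OF assms(2,3)])
qed

end
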